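(* Let $S$ be a finite semigroup. The cyclic graph $\Gamma(S)$ is equal to the commuting graph $P_c(S)$ if and only if every commutative subsemigroup of $S$ is monogenic.
   Context: Semigroups and subsemigroups are nonempty. $\mathbb{N}$ is the set of positive integers. For $X\subseteq S$, $\langle X\rangle$ is the subsemigroup generated by $X$; $\langle a\rangle=\{a^k:k\in\mathbb{N}\}$. A semigroup is monogenic if it equals $\langle a\rangle$ for some element $a$ of it. Both graphs are simple graphs with vertex set $S$. In $\Gamma(S)$, distinct $x,y$ are adjacent if and only if $\langle x,y\rangle=\langle z\rangle$ for some $z\in S$. In $P_c(S)$, distinct $x,y$ are adjacent if and only if $xy=yx$. Two graphs on $S$ are equal if they have the same edges. *)

theory Defs
  imports Main "HOL.Hull"
begin

text \<open>The ambient semigroup $S$ is the universe of a type of class \<^class>\<open>semigroup_mult\<close>;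
  it is nonempty because every type is.\<close>

definition subsemigroup :: "'a::semigroup_mult set \<Rightarrow> bool" where
  "subsemigroup T \<longleftrightarrow> T \<noteq> {} \<and> (\<forall>x\<in>T. \<forall>y\<in>T. x * y \<in> T)"

text \<open>$\langle X\rangle$ is the intersection of all subsemigroups containing $X$; it is a
  subsemigroup only for $X \neq \emptyset$, the only case in which it is used.\<close>

definition gen :: "'a::semigroup_mult set \<Rightarrow> 'a set" where
  "gen X = subsemigroup hull X"

lemma subsemigroup_gen:
  assumes "X \<noteq> {}"
  shows "subsemigroup (gen X)"
  using assms unfolding subsemigroup_def gen_def hull_def by blast

definition commutative_subsemigroup :: "'a::semigroup_mult set \<Rightarrow> bool" where
  "commutative_subsemigroup T \<longleftrightarrow> subsemigroup T \<and> (\<forall>x\<in>T. \<forall>y\<in>T. x * y = y * x)"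

definition monogenic :: "'a::semigroup_mult set \<Rightarrow> bool" where
  "monogenic T \<longleftrightarrow> (\<exists>a\<in>T. T = gen {a})"

text \<open>A simple graph is a pair of its vertex set and its set of (two-element) edges.\<close>

type_synonym 'a simple_graph = "'a set \<times> 'a set set"

definition cyclic_graph :: "'a::semigroup_mult simple_graph" where
  "cyclic_graph = (UNIV, {{x, y} | x y. x \<noteq> y \<and> (\<exists>z. gen {x, y} = gen {z})})"

definition commuting_graph :: "'a::semigroup_mult simple_graph" where
  "commuting_graph = (UNIV, {{x, y} | x y. x \<noteq> y \<and> x * y = y * x})"

end

theory Submission
  imports Defs
begin

text \<open>
  Two elements commute if and only if the subsemigroup that they generate is commutative.
  A subsemigroup generated by one element is commutative, so every edge of the cyclic graph is an
  edge of the commuting graph, and equality of the graphs means that any two commuting elements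
  generate a monogenic subsemigroup. Since what they generate is commutative, this is a special
  case of the condition on commutative subsemigroups.

  In the other direction, finiteness passes from pairs to all of a commutative subsemigroup \<open>T\<close>:
  choose \<open>c \<in> T\<close> for which \<open>\<langle>c\<rangle>\<close> has as many elements as possible. For \<open>t \<in> T\<close> the subsemigroup
  \<open>\<langle>c, t\<rangle>\<close> is \<open>\<langle>z\<rangle>\<close> for some \<open>z \<in> T\<close>, and it contains \<open>\<langle>c\<rangle>\<close>; by the choice of \<open>c\<close> the two are
  equal, so \<open>t \<in> \<langle>c\<rangle>\<close> (lemma \<open>monogenic_if_pairs_monogenic\<close>).
\<close>

lemma gen_superset: "X \<subseteq> gen X"
  unfolding gen_def by (rule hull_subset)

lemma gen_mono: "X \<subseteq> Y \<Longrightarrow> gen X \<subseteq> gen Y"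
  unfolding gen_def by (rule hull_mono)

lemma gen_least: "X \<subseteq> T \<Longrightarrow> subsemigroup T \<Longrightarrow> gen X \<subseteq> T"
  unfolding gen_def by (rule hull_minimal)

lemma monogenic_gen_iff: "monogenic (gen X) \<longleftrightarrow> (\<exists>z. gen X = gen {z})"
  unfolding monogenic_def using gen_superset by blast

text \<open>The elements that commute with all of a set \<open>A\<close> are closed under multiplication, so anything
  that commutes with the generators commutes with everything they generate. Applying this twice,
  once in each factor, gives the next lemma.\<close>

lemma gen_commutes_with:
  assumes "X \<noteq> {}" and commute: "\<And>x a. x \<in> X \<Longrightarrow> a \<in> A \<Longrightarrow> x * a = a * x"
    and "s \<in> gen X" and "a \<in> A"
  shows "s * a = a * s"
proof -
  let ?C = "{s. \<forall>a\<in>A. s * a = a * s}"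
  have "subsemigroup ?C"
    unfolding subsemigroup_def
  proof (intro conjI ballI)
    show "?C \<noteq> {}" using assms(1) commute by blast
    fix s t assume "s \<in> ?C" "t \<in> ?C"
    then have "s * t * a = a * (s * t)" if "a \<in> A" for a
      using that by (simp add: mult.assoc) (simp add: mult.assoc[symmetric])
    then show "s * t \<in> ?C" by blast
  qed
  moreover have "X \<subseteq> ?C" using commute by blast
  ultimately show ?thesis using gen_least assms(3,4) by blast
qed

lemma commutative_subsemigroup_gen:
  assumes "X \<noteq> {}" and "\<And>x y. x \<in> X \<Longrightarrow> y \<in> X \<Longrightarrow> x * y = y * x"
  shows "commutative_subsemigroup (gen X)"
proof -
  have "s * x = x * s" if "s \<in> gen X" "x \<in> X" for s x
    using gen_commutes_with[of X X] assms that by blast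
  then have "s * t = t * s" if "s \<in> gen X" "t \<in> gen X" for s t
    using gen_commutes_with[of X "gen X"] assms(1) that by simp
  then show ?thesis
    unfolding commutative_subsemigroup_def using subsemigroup_gen assms(1) by blast
qed

lemma commute_iff_commutative_gen:
  "x * y = y * x \<longleftrightarrow> commutative_subsemigroup (gen {x, y})"
proof
  assume "x * y = y * x"
  then show "commutative_subsemigroup (gen {x, y})"
    by (intro commutative_subsemigroup_gen) auto
next
  assume "commutative_subsemigroup (gen {x, y})"
  then show "x * y = y * x"
    unfolding commutative_subsemigroup_def using gen_superset[of "{x, y}"] by blast
qed

lemma commutative_subsemigroup_if_monogenic: "monogenic T \<Longrightarrow> commutative_subsemigroup T"
  unfolding monogenic_def using commutative_subsemigroup_gen[of "{a}" for a] by force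

text \<open>The graphs have no loops and so say nothing about the pairs \<open>x, x\<close>; these may be included on the
  right because \<open>\<langle>x, x\<rangle>\<close> is \<open>\<langle>x\<rangle>\<close>.\<close>

lemma graphs_eq_iff_commuting_pairs_monogenic:
  "(cyclic_graph :: 'a::semigroup_mult simple_graph) = commuting_graph \<longleftrightarrow>
    (\<forall>x y :: 'a. x * y = y * x \<longrightarrow> monogenic (gen {x, y}))"
proof
  assume eq: "(cyclic_graph :: 'a simple_graph) = commuting_graph"
  show "\<forall>x y :: 'a. x * y = y * x \<longrightarrow> monogenic (gen {x, y})"
  proof (intro allI impI)
    fix x y :: 'a
    assume comm: "x * y = y * x"
    show "monogenic (gen {x, y})"
    proof (cases "x = y")
      case True
      then show ?thesis by (auto simp: monogenic_gen_iff)
    next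
      case False
      with comm have "{x, y} \<in> snd (commuting_graph :: 'a simple_graph)"
        unfolding commuting_graph_def by auto
      with eq have "{x, y} \<in> snd (cyclic_graph :: 'a simple_graph)" by simp
      then obtain u v z where "{x, y} = {u, v}" "gen {u, v} = gen {z}"
        unfolding cyclic_graph_def by auto
      then show ?thesis by (auto simp: monogenic_gen_iff)
    qed
  qed
next
  assume "\<forall>x y :: 'a. x * y = y * x \<longrightarrow> monogenic (gen {x, y})"
  then have "(\<exists>z. gen {x, y} = gen {z}) \<longleftrightarrow> x * y = y * x" for x y :: 'a
    unfolding monogenic_gen_iff[symmetric]
    using commute_iff_commutative_gen commutative_subsemigroup_if_monogenic by blast
  then show "(cyclic_graph :: 'a simple_graph) = commuting_graph"
    unfolding cyclic_graph_def commuting_graph_def by simp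
qed

lemma monogenic_if_pairs_monogenic:
  assumes T: "subsemigroup T" and "finite T"
    and pairs: "\<And>x y. x \<in> T \<Longrightarrow> y \<in> T \<Longrightarrow> monogenic (gen {x, y})"
  shows "monogenic T"
proof -
  have gen_in_T: "gen X \<subseteq> T" if "X \<subseteq> T" for X
    using gen_least T that by blast
  have "T \<noteq> {}" using T by (simp add: subsemigroup_def)
  then obtain c where "c \<in> T" and max: "\<And>z. z \<in> T \<Longrightarrow> card (gen {z}) \<le> card (gen {c})"
    using \<open>finite T\<close> obtains_MAX[of T "\<lambda>c. card (gen {c})"] Max_ge
    by (metis finite_imageI imageI)
  have "t \<in> gen {c}" if t: "t \<in> T" for t
  proof -
    obtain z where "z \<in> gen {c, t}" and z: "gen {c, t} = gen {z}"
      using pairs[OF \<open>c \<in> T\<close> t] unfolding monogenic_def by blast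
    then have "z \<in> T" using gen_in_T[of "{c, t}"] \<open>c \<in> T\<close> t by blast
    have "gen {c} \<subseteq> gen {z}" using gen_mono[of "{c}" "{c, t}"] z by simp
    moreover have "finite (gen {z})"
      using gen_in_T[of "{z}"] \<open>z \<in> T\<close> \<open>finite T\<close> finite_subset by blast
    ultimately have "gen {c} = gen {z}" using max[OF \<open>z \<in> T\<close>] by (intro card_seteq)
    then show ?thesis using z gen_superset[of "{c, t}"] by blast
  qed
  then have "T = gen {c}" using gen_in_T[of "{c}"] \<open>c \<in> T\<close> by blast
  then show ?thesis unfolding monogenic_def using \<open>c \<in> T\<close> by blast
qed

theorem theorem4p12:
  shows "(cyclic_graph :: 'a::{finite, semigroup_mult} simple_graph) = commuting_graph \<longleftrightarrow>
    (\<forall>T :: 'a set. commutative_subsemigroup T \<longrightarrow> monogenic T)"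
  unfolding graphs_eq_iff_commuting_pairs_monogenic
proof
  assume pairs: "\<forall>x y :: 'a. x * y = y * x \<longrightarrow> monogenic (gen {x, y})"
  show "\<forall>T :: 'a set. commutative_subsemigroup T \<longrightarrow> monogenic T"
  proof (intro allI impI)
    fix T :: "'a set"
    assume T: "commutative_subsemigroup T"
    show "monogenic T"
    proof (rule monogenic_if_pairs_monogenic)
      show "subsemigroup T" using T unfolding commutative_subsemigroup_def ..
      show "finite T" by simp
      fix x y
      assume "x \<in> T" "y \<in> T"
      then have "x * y = y * x" using T unfolding commutative_subsemigroup_def by blast
      then show "monogenic (gen {x, y})" using pairs by blast
    qed
  qed
next
  assume "\<forall>T :: 'a set. commutative_subsemigroup T \<longrightarrow> monogenic T"
  then show "\<forall>x y :: 'a. x * y = y * x \<longrightarrow> monogenic (gen {x, y})"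
    unfolding commute_iff_commutative_gen by blast
qed

end
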